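(* Let $L$ be a finite-dimensional (right) Leibniz algebra over a field $F$, and let $I=\operatorname{span}\{[x,x] : x\in L\}$ be its Leibniz kernel. Suppose that $I\not\subseteq \phi(L)$, and let $B$ be a subalgebra of $L$ such that $L=I+B$ and $I\cap B\subseteq \phi(B)$. Then $$N(L/I)=(I+N(B))/I,$$ and, moreover, $N(L/I)=N(L)/I$ if and only if for every $n\in N(B)$ the restriction $R_n|_I : I\to I$, $y\mapsto [y,n]$, is a nilpotent linear map.
   Context: A (right) Leibniz algebra over a field $F$ is an $F$-vector space $L$ with a bilinear product $[\cdot,\cdot]$ satisfying $[x,[y,z]]=[[x,y],z]-[[x,z],y]$ for all $x,y,z\in L$; equivalently, each right multiplication $R_x:L\to L$, $y\mapsto [y,x]$, is a derivation. Ideals are two-sided. The Leibniz kernel $I=\operatorname{span}\{[x,x]:x\in L\}$ is an ideal of $L$, and $L/I$ is a Lie algebra. Put $L^1=L$ and $L^{k+1}=[L^k,L]$ for $k\ge 1$, where $[A,C]$ denotes the linear span of all products $[a,c]$ with $a\in A$, $c\in C$. $L$ is nilpotent if $L^n=0$ for some $n\in\mathbb{N}$. For a finite-dimensional Leibniz algebra $A$, the nilradical $N(A)$ is the largest nilpotent ideal of $A$ (it exists and contains every nilpotent ideal of $A$). The Frattini ideal $\phi(A)$ is the largest ideal of $A$ contained in every maximal subalgebra of $A$. *)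

theory Defs
  imports Complex_Main
begin

text \<open>
  The algebra \<open>L\<close> lives on a whole type, so that the library's vector spaces can be used for it.
  Its subalgebras and its quotients, however, have to be algebras in their own right.  The notions
  below are therefore stated for structures with an explicit carrier, which cover the three cases:
  the structure of \<open>L\<close> itself, the same structure with the carrier replaced by a subset, and
  the structure on the set of cosets of an ideal.
\<close>

record ('f, 'v) lstruct =
  lcarrier :: "'v set"
  lzero :: 'v
  ladd :: "'v \<Rightarrow> 'v \<Rightarrow> 'v"
  lscale :: "'f \<Rightarrow> 'v \<Rightarrow> 'v"
  lbracket :: "'v \<Rightarrow> 'v \<Rightarrow> 'v"

definition lsubspace :: "('f, 'v) lstruct \<Rightarrow> 'v set \<Rightarrow> bool" where
  "lsubspace A U \<longleftrightarrow> U \<subseteq> lcarrier A \<and> lzero A \<in> U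
     \<and> (\<forall>x\<in>U. \<forall>y\<in>U. ladd A x y \<in> U) \<and> (\<forall>c. \<forall>x\<in>U. lscale A c x \<in> U)"

definition lspan :: "('f, 'v) lstruct \<Rightarrow> 'v set \<Rightarrow> 'v set" where
  "lspan A S = \<Inter>{U. lsubspace A U \<and> S \<subseteq> U}"

definition lsum :: "('f, 'v) lstruct \<Rightarrow> 'v set \<Rightarrow> 'v set \<Rightarrow> 'v set" where
  "lsum A X Y = {ladd A x y |x y. x \<in> X \<and> y \<in> Y}"

definition lprod :: "('f, 'v) lstruct \<Rightarrow> 'v set \<Rightarrow> 'v set \<Rightarrow> 'v set" where
  "lprod A X Y = lspan A {lbracket A x y |x y. x \<in> X \<and> y \<in> Y}"

definition subalgebra :: "('f, 'v) lstruct \<Rightarrow> 'v set \<Rightarrow> bool" where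
  "subalgebra A U \<longleftrightarrow> lsubspace A U \<and> (\<forall>x\<in>U. \<forall>y\<in>U. lbracket A x y \<in> U)"

definition lideal :: "('f, 'v) lstruct \<Rightarrow> 'v set \<Rightarrow> bool" where
  "lideal A U \<longleftrightarrow> lsubspace A U
     \<and> (\<forall>u\<in>U. \<forall>a\<in>lcarrier A. lbracket A u a \<in> U \<and> lbracket A a u \<in> U)"

definition maximal_subalgebra :: "('f, 'v) lstruct \<Rightarrow> 'v set \<Rightarrow> bool" where
  "maximal_subalgebra A M \<longleftrightarrow> subalgebra A M \<and> M \<noteq> lcarrier A
     \<and> (\<forall>U. subalgebra A U \<and> M \<subseteq> U \<longrightarrow> U = M \<or> U = lcarrier A)"

text \<open>Here \<open>lower_central A k\<close> is \<open>A\<^sup>k\<^sup>+\<^sup>1\<close>.\<close>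

primrec lower_central :: "('f, 'v) lstruct \<Rightarrow> nat \<Rightarrow> 'v set" where
  "lower_central A 0 = lcarrier A"
| "lower_central A (Suc k) = lprod A (lower_central A k) (lcarrier A)"

definition lnilpotent :: "('f, 'v) lstruct \<Rightarrow> bool" where
  "lnilpotent A \<longleftrightarrow> (\<exists>k. lower_central A k = {lzero A})"

text \<open>
  In the next two definitions \<open>GREATEST\<close> refers to the inclusion order on sets, so that
  it denotes the ideal that contains all the others of the kind described.
\<close>

definition nilradical :: "('f, 'v) lstruct \<Rightarrow> 'v set" where
  "nilradical A = (GREATEST U. lideal A U \<and> lnilpotent (A\<lparr>lcarrier := U\<rparr>))"

definition frattini_ideal :: "('f, 'v) lstruct \<Rightarrow> 'v set" where
  "frattini_ideal A = (GREATEST U. lideal A U \<and> (\<forall>M. maximal_subalgebra A M \<longrightarrow> U \<subseteq> M))"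

definition leibniz_kernel :: "('f, 'v) lstruct \<Rightarrow> 'v set" where
  "leibniz_kernel A = lspan A {lbracket A x x |x. x \<in> lcarrier A}"

definition lcoset :: "('f, 'v) lstruct \<Rightarrow> 'v set \<Rightarrow> 'v \<Rightarrow> 'v set" where
  "lcoset A I x = {ladd A x i |i. i \<in> I}"

text \<open>
  The quotient by an ideal \<open>I\<close>.  Each operation takes the union of the cosets of the results
  over all representatives; for an ideal these cosets coincide.  (The mere elementwise image would
  not do: \<open>0 \<cdot> (x + I)\<close> has to be \<open>I\<close> and not \<open>{0}\<close>.)
\<close>

definition lquotient :: "('f, 'v) lstruct \<Rightarrow> 'v set \<Rightarrow> ('f, 'v set) lstruct" where
  "lquotient A I =
     \<lparr>lcarrier = lcoset A I ` lcarrier A,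
      lzero = I,
      ladd = (\<lambda>X Y. \<Union>x\<in>X. \<Union>y\<in>Y. lcoset A I (ladd A x y)),
      lscale = (\<lambda>c X. \<Union>x\<in>X. lcoset A I (lscale A c x)),
      lbracket = (\<lambda>X Y. \<Union>x\<in>X. \<Union>y\<in>Y. lcoset A I (lbracket A x y))\<rparr>"

locale leibniz_algebra = vector_space scale
  for scale :: "'f::field \<Rightarrow> 'v::ab_group_add \<Rightarrow> 'v" +
  fixes bracket :: "'v \<Rightarrow> 'v \<Rightarrow> 'v"
  assumes linear_bracket_left: "Vector_Spaces.linear scale scale (\<lambda>x. bracket x y)"
    and linear_bracket_right: "Vector_Spaces.linear scale scale (\<lambda>y. bracket x y)"
    and leibniz_identity:
      "bracket x (bracket y z) = bracket (bracket x y) z - bracket (bracket x z) y"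

definition lstruct_of ::
  "('f \<Rightarrow> 'v \<Rightarrow> 'v) \<Rightarrow> ('v \<Rightarrow> 'v \<Rightarrow> 'v) \<Rightarrow> ('f, 'v::ab_group_add) lstruct" where
  "lstruct_of scale bracket =
     \<lparr>lcarrier = UNIV, lzero = 0, ladd = (+), lscale = scale, lbracket = bracket\<rparr>"

end

theory Submission
  imports Defs
begin

text \<open>
  Since \<open>L/I \<cong> B/(I \<inter> B)\<close> and \<open>I \<inter> B \<subseteq> \<phi>(B)\<close>, the first claim says that an ideal \<open>C\<close> of \<open>B\<close> which is
  nilpotent modulo \<open>\<phi>(B)\<close> is nilpotent.  For \<open>c \<in> C\<close> the map \<open>R\<^sub>c\<close> is a derivation of \<open>B\<close> with
  \<open>R\<^sub>c\<^sup>k B \<subseteq> \<phi>(B)\<close>, so by Fitting's lemma \<open>B\<close> is the sum of \<open>\<phi>(B)\<close> and of the null component of \<open>R\<^sub>c\<close>.  The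
  latter is a subalgebra, hence lies in a maximal subalgebra unless it is all of \<open>B\<close>; thus \<open>R\<^sub>c\<close> is
  nilpotent, and \<open>C\<close> is nilpotent by Engel's theorem.  For the second claim, \<open>[L, I] = 0\<close> gives
  \<open>R\<^sub>i\<^sub>+\<^sub>n = R\<^sub>n\<close> for \<open>i \<in> I\<close>, so Engel's theorem applied to \<open>I + N(B)\<close> reduces the nilpotency of this ideal to
  that of the maps \<open>R\<^sub>n\<close> on \<open>I\<close>.
\<close>

subsection \<open>Right multiplications and nilpotent actions\<close>

context leibniz_algebra
begin

notation bracket (infixl "\<cdot>" 70)
notation scale (infixr "*s" 75)

lemma bracket_add_left: "(x + y) \<cdot> z = x \<cdot> z + y \<cdot> z"
  and bracket_scale_left: "(c *s x) \<cdot> z = c *s (x \<cdot> z)"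
  and bracket_add_right: "z \<cdot> (x + y) = z \<cdot> x + z \<cdot> y"
  and bracket_scale_right: "z \<cdot> (c *s x) = c *s (z \<cdot> x)"
  using linear_bracket_left[of z] linear_bracket_right[of z] by (auto simp: Vector_Spaces.linear_iff)

lemma bracket_zero_left [simp]: "0 \<cdot> z = 0"
  using bracket_add_left[of 0 0 z] by simp

lemma bracket_zero_right [simp]: "z \<cdot> 0 = 0"
  using bracket_add_right[of z 0 0] by simp

lemma bracket_diff_left: "(x - y) \<cdot> z = x \<cdot> z - y \<cdot> z"
  using bracket_add_left[of "x - y" y z] by (simp add: algebra_simps)

lemma bracket_diff_right: "z \<cdot> (x - y) = z \<cdot> x - z \<cdot> y"
  using bracket_add_right[of z "x - y" y] by (simp add: algebra_simps)

lemmas bracket_linear = bracket_add_left bracket_add_right bracket_scale_left bracket_scale_right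
  bracket_diff_left bracket_diff_right

text \<open>The Leibniz identity read as a derivation rule for right multiplication by
  \<open>z\<close>; in this form it moves \<open>z\<close> leftwards past \<open>y\<close>.\<close>

lemma bracket_swap_right: "x \<cdot> y \<cdot> z = x \<cdot> z \<cdot> y + x \<cdot> (y \<cdot> z)"
  by (simp add: leibniz_identity)

text \<open>The two terms of the Leibniz identity cancel when its last two arguments agree. Hence
  right multiplications depend only on the class modulo squares, that is, on a Lie algebra.\<close>

lemma bracket_square_right: "z \<cdot> (x \<cdot> x) = 0"
  by (simp add: leibniz_identity)

lemma bracket_antisym_right: "z \<cdot> (x \<cdot> y) = - (z \<cdot> (y \<cdot> x))"
  by (simp add: leibniz_identity)

definition right_mult :: "'v \<Rightarrow> 'v \<Rightarrow> 'v" where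
  "right_mult a = (\<lambda>z. z \<cdot> a)"

lemma right_mult_apply [simp]: "right_mult a z = z \<cdot> a"
  by (simp add: right_mult_def)

lemma right_mult_pow_add: "(right_mult a ^^ n) (x + y) = (right_mult a ^^ n) x + (right_mult a ^^ n) y"
  by (induction n) (simp_all add: bracket_linear)

lemma right_mult_pow_scale: "(right_mult a ^^ n) (c *s x) = c *s (right_mult a ^^ n) x"
  by (induction n) (simp_all add: bracket_linear)

lemma right_mult_pow_zero [simp]: "(right_mult a ^^ n) 0 = 0"
  by (induction n) simp_all

lemma right_mult_pow_diff: "(right_mult a ^^ n) (x - y) = (right_mult a ^^ n) x - (right_mult a ^^ n) y"
  by (induction n) (simp_all add: bracket_linear)

lemma right_mult_pow_mem:
  assumes "\<And>v. v \<in> V \<Longrightarrow> v \<cdot> a \<in> V" "x \<in> V"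
  shows "(right_mult a ^^ n) x \<in> V"
  using assms by (induction n) simp_all

lemma right_mult_pow_le:
  assumes "(right_mult a ^^ m) x = 0" "m \<le> n"
  shows "(right_mult a ^^ n) x = 0"
  using assms by (metis right_mult_pow_zero funpow_add le_add_diff_inverse2 o_apply)

lemma subspace_right_mult_pow_image:
  assumes "subspace V" shows "subspace ((right_mult a ^^ n) ` V)"
proof (rule subspaceI)
  show "0 \<in> (right_mult a ^^ n) ` V"
    using subspace_0[OF assms] by (metis image_eqI right_mult_pow_zero)
  show "x + y \<in> (right_mult a ^^ n) ` V"
    if "x \<in> (right_mult a ^^ n) ` V" "y \<in> (right_mult a ^^ n) ` V" for x y
    using that subspace_add[OF assms] by (auto simp flip: right_mult_pow_add)
  show "c *s x \<in> (right_mult a ^^ n) ` V" if "x \<in> (right_mult a ^^ n) ` V" for c x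
    using that subspace_scale[OF assms] by (auto simp flip: right_mult_pow_scale)
qed

text \<open>Spanned by the left-normed words with first letter in \<open>V\<close> and
  \<open>n\<close> further letters in \<open>C\<close>. For a subalgebra \<open>V = C\<close> this
  is the lower central series; a separate \<open>V\<close> lets Engel's theorem speak of
  modules.\<close>

primrec right_power :: "'v set \<Rightarrow> 'v set \<Rightarrow> nat \<Rightarrow> 'v set" where
  "right_power V C 0 = V"
| "right_power V C (Suc n) = span {x \<cdot> c |x c. x \<in> right_power V C n \<and> c \<in> C}"

lemma subspace_right_power: "subspace V \<Longrightarrow> subspace (right_power V C n)"
  by (cases n) simp_all

lemma right_power_step: "x \<in> right_power V C n \<Longrightarrow> c \<in> C \<Longrightarrow> x \<cdot> c \<in> right_power V C (Suc n)"
  by (auto intro!: span_base)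

lemma right_power_Suc_subset:
  assumes "subspace V" "\<forall>v\<in>V. \<forall>c\<in>C. v \<cdot> c \<in> V"
  shows "right_power V C (Suc n) \<subseteq> right_power V C n"
proof (induction n)
  case 0
  show ?case unfolding right_power.simps using assms by (intro span_minimal) auto
next
  case (Suc n)
  show ?case unfolding right_power.simps(2)[of V C "Suc n"]
    using right_power_step[of _ V C n] Suc subspace_right_power[OF assms(1), of C "Suc n"]
    by (intro span_minimal) blast+
qed

lemma right_power_antimono:
  assumes "subspace V" "\<forall>v\<in>V. \<forall>c\<in>C. v \<cdot> c \<in> V" "m \<le> n"
  shows "right_power V C n \<subseteq> right_power V C m"
  using lift_Suc_antimono_le[of "right_power V C", OF right_power_Suc_subset] assms by blast

lemma right_power_mono:
  assumes "V \<subseteq> V'" "C \<subseteq> C'" shows "right_power V C n \<subseteq> right_power V' C' n"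
proof (induction n)
  case (Suc n)
  then have "{x \<cdot> c |x c. x \<in> right_power V C n \<and> c \<in> C}
      \<subseteq> {x \<cdot> c |x c. x \<in> right_power V' C' n \<and> c \<in> C'}"
    using assms by blast
  then show ?case by (simp add: span_mono)
qed (use assms in simp)

lemma foldl_in_right_power:
  assumes "v \<in> right_power V C k" "set cs \<subseteq> C"
  shows "foldl (\<cdot>) v cs \<in> right_power V C (k + length cs)"
  using assms
proof (induction cs arbitrary: v k)
  case (Cons c cs)
  then show ?case using right_power_step[of v V C k c] Cons.IH[of "v \<cdot> c" "Suc k"] by simp
qed simp

lemma right_mult_pow_in_right_power:
  assumes "v \<in> V" "c \<in> C"
  shows "(right_mult c ^^ n) v \<in> right_power V C n"
  using assms right_power_step by (induction n) simp_all

lemma foldl_bracket_diff: "foldl (\<cdot>) (x - y) cs = foldl (\<cdot>) x cs - foldl (\<cdot>) y cs"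
  by (induction cs arbitrary: x y) (simp_all add: bracket_diff_left)

lemma foldl_bracket_zero [simp]: "foldl (\<cdot>) 0 cs = 0"
  by (induction cs) simp_all

text \<open>
  By the Leibniz identity, \<open>v \<cdot> (a \<cdot> d\<^sub>1 \<cdot> \<dots> \<cdot> d\<^sub>k)\<close> is a combination of words in which the \<open>k\<close> letters from \<open>D\<close>
  are distributed to the left and to the right of the single letter \<open>a\<close>; if there are at least \<open>2n\<close> of
  them, then \<open>n\<close> are on one side.
\<close>

lemma nilpotent_action_kills_right_normed:
  assumes V: "subspace V" and C: "\<forall>v\<in>V. \<forall>c\<in>C. v \<cdot> c \<in> V"
    and CC: "\<forall>x\<in>C. \<forall>y\<in>C. x \<cdot> y \<in> C"
    and D: "D \<subseteq> C" and n: "right_power V D n \<subseteq> {0}"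
    and v: "v \<in> right_power V D p" and a: "a \<in> C"
    and ds: "set ds \<subseteq> D" "set es \<subseteq> D"
    and len: "p + length ds + length es \<ge> 2 * n"
  shows "foldl (\<cdot>) (v \<cdot> foldl (\<cdot>) a ds) es = 0"
  using v ds len
proof (induction ds arbitrary: v p es rule: rev_induct)
  case Nil
  have VD: "\<forall>v\<in>V. \<forall>c\<in>D. v \<cdot> c \<in> V" using C D by blast
  show ?case
  proof (cases "p \<ge> n")
    case True
    then have "v = 0" using right_power_antimono[OF V VD True] n Nil.prems by auto
    then show ?thesis by simp
  next
    case False
    then have "length es \<ge> n" using Nil.prems by simp
    moreover have "v \<in> V"
      using right_power_antimono[OF V VD, of 0 p] Nil.prems by auto
    then have "v \<cdot> a \<in> right_power V D 0" using C a by simp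
    then have "foldl (\<cdot>) (v \<cdot> a) es \<in> right_power V D (0 + length es)"
      using Nil.prems by (intro foldl_in_right_power)
    ultimately show ?thesis using right_power_antimono[OF V VD, of n "length es"] n by auto
  qed
next
  case (snoc d ds)
  let ?a = "foldl (\<cdot>) a ds"
  have d: "d \<in> D" "set ds \<subseteq> D" using snoc.prems by auto
  \<comment> \<open>The last letter \<open>d\<close> either moves to the front of \<open>es\<close>
    or is absorbed by \<open>v\<close>, which raises \<open>p\<close> by one; the total count is
    unchanged.\<close>
  have "foldl (\<cdot>) (v \<cdot> ?a) (d # es) = 0"
    using snoc.prems d by (intro snoc.IH[of v p]) auto
  moreover have "foldl (\<cdot>) (v \<cdot> d \<cdot> ?a) es = 0"
    using snoc.prems d right_power_step[of v V D p d] by (intro snoc.IH[of _ "Suc p"]) auto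
  ultimately show ?case by (simp add: leibniz_identity foldl_bracket_diff)
qed

text \<open>\<open>D\<close> maps the \<open>i\<close>-th term of its series into the next one, so
  on the quotient of the two a factor \<open>d + t *s b\<close> acts as \<open>t\<close> times
  \<open>b\<close>. After \<open>m\<close> such factors the nilpotency of \<open>b\<close> pushes
  everything one term down.\<close>

lemma right_power_insert_subset:
  assumes V: "subspace V" and D: "subspace D"
    and VD: "\<forall>v\<in>V. \<forall>d\<in>D. v \<cdot> d \<in> V"
    and Vb: "\<And>v. v \<in> V \<Longrightarrow> v \<cdot> b \<in> V"
    and Db: "\<And>d. d \<in> D \<Longrightarrow> d \<cdot> b \<in> D"
    and m: "\<And>v. v \<in> V \<Longrightarrow> (right_mult b ^^ m) v = 0"
  shows "right_power V (span (insert b D)) (i * m) \<subseteq> right_power V D i"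
proof (induction i)
  case (Suc i)
  let ?P = "right_power V D" and ?D' = "span (insert b D)"
  have sP: "subspace (?P j)" for j by (rule subspace_right_power[OF V])
  have dec: "?P (Suc j) \<subseteq> ?P j" for j by (rule right_power_Suc_subset[OF V VD])
  \<comment> \<open>Each term is stable under \<open>b\<close>, since right multiplication by
    \<open>b\<close> is a derivation and preserves both \<open>V\<close> and
    \<open>D\<close>.\<close>
  have Pb: "x \<cdot> b \<in> ?P j" if "x \<in> ?P j" for x j
    using that
  proof (induction j arbitrary: x)
    case (Suc j)
    have "{x. x \<cdot> b \<in> ?P (Suc j)} \<supseteq> ?P (Suc j)"
      unfolding right_power.simps(2)
    proof (rule span_minimal)
      show "{x \<cdot> c |x c. x \<in> ?P j \<and> c \<in> D} \<subseteq> {x. x \<cdot> b \<in> span {x \<cdot> c |x c. x \<in> ?P j \<and> c \<in> D}}"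
      proof safe
        fix x d assume "x \<in> ?P j" "d \<in> D"
        then have "x \<cdot> b \<cdot> d \<in> ?P (Suc j)" "x \<cdot> (d \<cdot> b) \<in> ?P (Suc j)"
          using Suc.IH Db right_power_step by blast+
        then show "x \<cdot> d \<cdot> b \<in> span {x \<cdot> c |x c. x \<in> ?P j \<and> c \<in> D}"
          using span_add unfolding bracket_swap_right[of x d b] right_power.simps(2) by blast
      qed
      show "subspace {x. x \<cdot> b \<in> span {x \<cdot> c |x c. x \<in> ?P j \<and> c \<in> D}}"
        by (rule subspaceI) (auto simp: bracket_linear intro: span_add span_scale span_zero)
    qed
    then show ?case using Suc.prems by blast
  qed (use Vb in simp)
  \<comment> \<open>What is left of the \<open>i\<close>-th term after \<open>l\<close> factors: the
    image under the \<open>l\<close>-th power of \<open>b\<close>, modulo the next term.\<close>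
  define T where "T l = {x + y |x y. x \<in> (right_mult b ^^ l) ` ?P i \<and> y \<in> ?P (Suc i)}" for l
  have sT: "subspace (T l)" for l
    unfolding T_def by (intro subspace_sums subspace_right_mult_pow_image sP)
  have "right_power V ?D' (i * m + l) \<subseteq> T l" for l
  proof (induction l)
    case 0
    show ?case
    proof
      fix x assume "x \<in> right_power V ?D' (i * m + 0)"
      then have "x \<in> ?P i" using Suc by auto
      then have "x + 0 \<in> T 0" unfolding T_def using subspace_0[OF sP] by fastforce
      then show "x \<in> T 0" by simp
    qed
  next
    case (Suc l)
    show ?case unfolding add_Suc_right right_power.simps(2)
    proof (rule span_minimal[OF _ sT], safe)
      fix x c assume x: "x \<in> right_power V ?D' (i * m + l)" and "c \<in> ?D'"
      then obtain t where "c - t *s b \<in> D" using D by (auto simp: span_breakdown_eq span_eq_iff[THEN iffD2])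
      then obtain d where d: "d \<in> D" "c = d + t *s b" by (metis diff_add_cancel)
      from x Suc obtain u y where uy: "u \<in> ?P i" "y \<in> ?P (Suc i)" "x = (right_mult b ^^ l) u + y"
        unfolding T_def by blast
      have "(right_mult b ^^ l) u \<in> ?P i" using Pb uy(1) by (rule right_mult_pow_mem)
      then have xi: "x \<in> ?P i" using uy dec subspace_add[OF sP] by blast
      have "x \<cdot> c = (right_mult b ^^ Suc l) (t *s u) + (t *s (y \<cdot> b) + x \<cdot> d)"
        using d uy by (simp add: bracket_linear right_mult_pow_scale scale_right_distrib algebra_simps)
      moreover have "(right_mult b ^^ Suc l) (t *s u) \<in> (right_mult b ^^ Suc l) ` ?P i"
        using subspace_scale[OF sP uy(1)] by (rule imageI)
      moreover have "t *s (y \<cdot> b) + x \<cdot> d \<in> ?P (Suc i)"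
        using right_power_step[OF xi d(1)] Pb[OF uy(2)] subspace_add[OF sP] subspace_scale[OF sP] by blast
      ultimately show "x \<cdot> c \<in> T (Suc l)" unfolding T_def by blast
    qed
  qed
  from this[of m] have "right_power V ?D' (Suc i * m) \<subseteq> T m" by (simp add: add.commute)
  \<comment> \<open>At \<open>l = m\<close> the image under the power of \<open>b\<close> is zero,
    so only the next term survives.\<close>
  moreover have "T m \<subseteq> ?P (Suc i)"
  proof -
    have "?P i \<subseteq> V" using right_power_antimono[OF V VD, of 0 i] by simp
    then show ?thesis unfolding T_def using m by auto
  qed
  ultimately show ?case by blast
qed simp

end

section \<open>Finite dimension and Engel's theorem\<close>

locale fd_leibniz_algebra = leibniz_algebra scale bracket + finite_dimensional_vector_space scale Basis
  for scale :: "'f::field \<Rightarrow> 'v::ab_group_add \<Rightarrow> 'v" and bracket and Basis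
begin

text \<open>Dimensions are bounded, so maximality is sought by dimension; no chain argument is
  involved.\<close>

lemma exists_max_subspace:
  assumes "P U0"
  obtains U where "P U" "\<And>W. P W \<Longrightarrow> dim W \<le> dim U"
proof -
  have "\<forall>y. P y \<longrightarrow> dim y < Suc dimension" using dim_subset_UNIV by (simp add: less_Suc_eq_le)
  from ex_has_greatest_nat[of P U0, OF assms this] show ?thesis using that by blast
qed

text \<open>
  A subalgebra \<open>D\<close> that is maximal among those acting nilpotently can be enlarged by any \<open>b\<close> with
  \<open>[b, D] \<subseteq> D\<close>.  Taking \<open>D\<close> to contain the kernel \<open>K\<close> of the action provides such a \<open>b\<close>, because long
  products \<open>a \<cdot> d\<^sub>1 \<cdot> \<dots> \<cdot> d\<^sub>k\<close> lie in \<open>K\<close>, and makes \<open>D + Fb\<close> a subalgebra, because the action factors through a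
  Lie algebra.
\<close>

lemma engel:
  assumes V: "subspace V" and C: "subspace C"
    and CC: "\<forall>x\<in>C. \<forall>y\<in>C. x \<cdot> y \<in> C"
    and VC: "\<forall>v\<in>V. \<forall>c\<in>C. v \<cdot> c \<in> V"
    and nil: "\<And>c. c \<in> C \<Longrightarrow> \<exists>m. \<forall>v\<in>V. (right_mult c ^^ m) v = 0"
  shows "\<exists>n. right_power V C n \<subseteq> {0}"
proof -
  \<comment> \<open>The kernel of the action of \<open>C\<close> on \<open>V\<close>; it is the
    starting point of the maximality argument and is kept inside \<open>D\<close>.\<close>
  define K where "K = {c \<in> C. \<forall>v\<in>V. v \<cdot> c = 0}"
  define P where "P D \<longleftrightarrow> subspace D \<and> K \<subseteq> D \<and> D \<subseteq> C \<and> (\<forall>x\<in>D. \<forall>y\<in>D. x \<cdot> y \<in> D)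
    \<and> (\<exists>n. right_power V D n \<subseteq> {0})" for D
  have "subspace K" unfolding K_def
    by (rule subspaceI)
      (simp_all add: subspace_0[OF C] subspace_add[OF C] subspace_scale[OF C] bracket_linear)
  moreover have "right_power V K (Suc 0) \<subseteq> {0}"
    unfolding right_power.simps by (rule span_minimal) (auto simp: K_def)
  moreover have "\<forall>x\<in>K. \<forall>y\<in>K. x \<cdot> y \<in> K"
    using CC by (auto simp: K_def leibniz_identity)
  moreover have "K \<subseteq> C" by (auto simp: K_def)
  ultimately have "P K" unfolding P_def by blast
  then obtain D where "P D" and max: "\<And>W. P W \<Longrightarrow> dim W \<le> dim D"
    using exists_max_subspace by blast
  then obtain n where D: "subspace D" and KD: "K \<subseteq> D" and DC: "D \<subseteq> C"
    and DD: "\<And>x y. x \<in> D \<Longrightarrow> y \<in> D \<Longrightarrow> x \<cdot> y \<in> D" and n: "right_power V D n \<subseteq> {0}"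
    unfolding P_def by blast
  have "D = C"
  proof (rule ccontr)
    assume "D \<noteq> C"
    then obtain a where a: "a \<in> C" "a \<notin> D" using DC by blast
    \<comment> \<open>Otherwise \<open>a\<close> could be multiplied by elements of \<open>D\<close>
      forever without entering \<open>D\<close>. But a word with \<open>2 * n\<close> letters from
      \<open>D\<close> acts as zero on \<open>V\<close>, hence lies in \<open>K\<close> and so in
      \<open>D\<close>.\<close>
    have "\<exists>b\<in>C - D. \<forall>d\<in>D. b \<cdot> d \<in> D"
    proof (rule ccontr)
      assume "\<not> ?thesis"
      then have ex: "\<exists>d\<in>D. b \<cdot> d \<notin> D" if "b \<in> C - D" for b using that by blast
      have "\<exists>ds. length ds = k \<and> set ds \<subseteq> D \<and> foldl (\<cdot>) a ds \<in> C - D" for k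
      proof (induction k)
        case (Suc k)
        then obtain ds where ds: "length ds = k" "set ds \<subseteq> D" "foldl (\<cdot>) a ds \<in> C - D" by blast
        with ex obtain d where "d \<in> D" "foldl (\<cdot>) a ds \<cdot> d \<notin> D" by blast
        then show ?case using ds CC DC by (intro exI[of _ "ds @ [d]"]) auto
      qed (use a in auto)
      then obtain ds where ds: "length ds = 2 * n" "set ds \<subseteq> D" "foldl (\<cdot>) a ds \<in> C - D" by blast
      have "v \<cdot> foldl (\<cdot>) a ds = 0" if "v \<in> V" for v
        using nilpotent_action_kills_right_normed[OF V VC CC DC n, of v 0 a ds "[]"] that ds a by simp
      then have "foldl (\<cdot>) a ds \<in> K" using ds by (simp add: K_def)
      then show False using ds KD by blast
    qed
    then obtain b where b: "b \<in> C" "b \<notin> D" and bD: "\<And>d. d \<in> D \<Longrightarrow> b \<cdot> d \<in> D" by blast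
    have bb: "b \<cdot> b \<in> D"
      using KD CC b bracket_square_right by (auto simp: K_def)
    \<comment> \<open>Right multiplication by \<open>d \<cdot> b\<close> is the negative of that by
      \<open>b \<cdot> d\<close>, so the sum of the two products lies in \<open>K\<close>; hence
      \<open>b\<close> normalises \<open>D\<close> from both sides.\<close>
    have Db: "d \<cdot> b \<in> D" if "d \<in> D" for d
    proof -
      have "d \<cdot> b + b \<cdot> d \<in> K"
        using that DC b CC subspace_add[OF C] bracket_antisym_right[of _ d b]
        by (auto simp: K_def bracket_linear)
      then show ?thesis using KD bD[OF that] subspace_diff[OF D] by (metis add_diff_cancel_right' subsetD)
    qed
    let ?D' = "span (insert b D)"
    have memD': "x \<in> ?D' \<longleftrightarrow> (\<exists>d t. d \<in> D \<and> x = d + t *s b)" for x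
      using D unfolding span_breakdown_eq span_eq_iff[THEN iffD2, OF D]
      by (metis diff_add_cancel add_diff_cancel)
    have "D \<subseteq> ?D'" by (metis span_superset insert_subset)
    \<comment> \<open>All four products of the components, including \<open>b \<cdot> b\<close>,
      fall into \<open>D\<close>, so the enlarged space is a subalgebra.\<close>
    have "x \<cdot> y \<in> D" if xy: "x \<in> ?D'" "y \<in> ?D'" for x y
    proof -
      obtain d t d' t' where "d \<in> D" "x = d + t *s b" "d' \<in> D" "y = d' + t' *s b"
        using xy memD' by meson
      then show ?thesis using bb Db bD DD subspace_add[OF D] subspace_scale[OF D]
        by (simp add: bracket_linear)
    qed
    moreover have "?D' \<subseteq> C" using b DC C by (intro span_minimal) auto
    moreover obtain m where "\<forall>v\<in>V. (right_mult b ^^ m) v = 0" using nil b by blast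
    then have "right_power V ?D' (n * m) \<subseteq> {0}"
      using right_power_insert_subset[OF V D, of b m n] VC DC b Db n by blast
    ultimately have "P ?D'" unfolding P_def using KD \<open>D \<subseteq> ?D'\<close> by blast
    then have "D = ?D'"
      using max[of ?D'] \<open>D \<subseteq> ?D'\<close> D by (intro subspace_dim_equal subspace_span)
    then show False using b by (metis span_base insertI1)
  qed
  then show ?thesis using n by blast
qed

end

subsection \<open>Nilradical and Frattini ideal\<close>

context leibniz_algebra
begin

text \<open>Both \<open>L\<close> (as \<open>restr UNIV\<close>) and its subalgebras have this form,
  so the carrier-based notions can be translated once and for all into \<open>subspace\<close> and
  \<open>span\<close> on the type.\<close>

abbreviation restr :: "'v set \<Rightarrow> ('f, 'v) lstruct" where
  "restr A \<equiv> (lstruct_of scale bracket)\<lparr>lcarrier := A\<rparr>"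

lemma lstruct_of_eq_restr: "lstruct_of scale bracket = restr UNIV"
  by (simp add: lstruct_of_def)

lemma restr_simps [simp]:
  "lcarrier (restr A) = A" "lzero (restr A) = 0" "ladd (restr A) = (+)"
  "lscale (restr A) = scale" "lbracket (restr A) = bracket"
  by (simp_all add: lstruct_of_def)

lemma lsubspace_restr: "lsubspace (restr A) U \<longleftrightarrow> subspace U \<and> U \<subseteq> A"
  unfolding lsubspace_def subspace_def by auto

lemma lspan_restr:
  assumes "subspace A" "S \<subseteq> A" shows "lspan (restr A) S = span S"
proof
  show "lspan (restr A) S \<subseteq> span S"
    using assms span_superset[of S] span_minimal[of S A] by (auto simp: lspan_def lsubspace_restr)
  show "span S \<subseteq> lspan (restr A) S"
    unfolding lspan_def lsubspace_restr using span_minimal by blast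
qed

lemma subalgebra_restr:
  "subalgebra (restr A) U \<longleftrightarrow> subspace U \<and> U \<subseteq> A \<and> (\<forall>x\<in>U. \<forall>y\<in>U. x \<cdot> y \<in> U)"
  by (auto simp: subalgebra_def lsubspace_restr)

lemma lideal_restr:
  "lideal (restr A) U \<longleftrightarrow> subspace U \<and> U \<subseteq> A \<and> (\<forall>u\<in>U. \<forall>a\<in>A. u \<cdot> a \<in> U \<and> a \<cdot> u \<in> U)"
  by (auto simp: lideal_def lsubspace_restr)

lemma lideal_imp_subalgebra: "lideal (restr A) U \<Longrightarrow> subalgebra (restr UNIV) U"
  by (auto simp: lideal_restr subalgebra_restr)

lemma lower_central_restr:
  assumes "subalgebra (restr UNIV) A"
  shows "lower_central (restr A) k = right_power A A k"
proof (induction k)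
  case (Suc k)
  have "right_power A A k \<subseteq> A"
    using right_power_antimono[of A A 0 k] assms by (auto simp: subalgebra_restr)
  then show ?case using Suc assms
    by (subst lower_central.simps, subst lprod_def, subst lspan_restr) (auto simp: subalgebra_restr)
qed simp

lemma lnilpotent_restr:
  assumes "subalgebra (restr UNIV) A"
  shows "lnilpotent (restr A) \<longleftrightarrow> (\<exists>k. right_power A A k \<subseteq> {0})"
  using subspace_0[OF subspace_right_power, of A A] assms
  by (auto simp: lnilpotent_def lower_central_restr subalgebra_restr)

lemma lideal_sum:
  assumes "lideal (restr A) U" "lideal (restr A) W" "subspace A"
  shows "lideal (restr A) {u + w |u w. u \<in> U \<and> w \<in> W}"
  unfolding lideal_restr
proof safe
  show "subspace {u + w |u w. u \<in> U \<and> w \<in> W}"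
    using assms by (intro subspace_sums) (auto simp: lideal_restr)
  fix u w assume uw: "u \<in> U" "w \<in> W"
  show "u + w \<in> A" using uw assms subspace_add[of A u w] by (auto simp: lideal_restr)
  fix a assume "a \<in> A"
  then show "\<exists>u' w'. (u + w) \<cdot> a = u' + w' \<and> u' \<in> U \<and> w' \<in> W"
      "\<exists>u' w'. a \<cdot> (u + w) = u' + w' \<and> u' \<in> U \<and> w' \<in> W"
    using uw assms unfolding bracket_add_left bracket_add_right lideal_restr by blast+
qed

lemma subspace_right_mult_vimage: "subspace T \<Longrightarrow> subspace {x. x \<cdot> c \<in> T}"
  by (rule subspaceI) (simp_all add: bracket_linear subspace_0 subspace_add subspace_scale)

text \<open>Right multiplication by \<open>a\<close> is a derivation that maps \<open>U\<close> into
  itself, so it preserves every term of the lower central series of \<open>U\<close>.\<close>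

lemma right_power_right_ideal:
  assumes U: "lideal (restr A) U" and "x \<in> right_power U U k" "a \<in> A"
  shows "x \<cdot> a \<in> right_power U U k"
  using assms(2)
proof (induction k arbitrary: x)
  case 0
  then show ?case using assms by (auto simp: lideal_restr)
next
  case (Suc k)
  let ?T = "right_power U U (Suc k)"
  have sT: "subspace ?T" using U by (intro subspace_right_power) (simp add: lideal_restr)
  have "?T \<subseteq> {x. x \<cdot> a \<in> ?T}"
    unfolding right_power.simps(2)[of U U k]
  proof (rule span_minimal[OF _ subspace_right_mult_vimage[OF sT, unfolded right_power.simps(2)]], safe)
    fix y u assume yu: "y \<in> right_power U U k" "u \<in> U"
    have "u \<cdot> a \<in> U" using U yu \<open>a \<in> A\<close> by (auto simp: lideal_restr)
    then have "y \<cdot> (u \<cdot> a) \<in> ?T" "y \<cdot> a \<cdot> u \<in> ?T"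
      using yu Suc.IH by (blast intro: right_power_step)+
    then show "y \<cdot> u \<cdot> a \<in> span {x \<cdot> c |x c. x \<in> right_power U U k \<and> c \<in> U}"
      using subspace_add[OF sT] unfolding bracket_swap_right[of y u a] right_power.simps(2) by blast
  qed
  then show ?case using Suc.prems by blast
qed

section \<open>Nilpotent ideals and their sums\<close>

definition nilpotent_ideal :: "'v set \<Rightarrow> 'v set \<Rightarrow> bool" where
  "nilpotent_ideal A U \<longleftrightarrow> lideal (restr A) U \<and> lnilpotent (restr U)"

text \<open>The series \<open>A\<close>, \<open>U\<close>, \<open>[U, U]\<close>, and so on, indexed
  by the number of factors from \<open>U\<close>. Starting with \<open>A\<close> at index 0 lets
  words without a factor from \<open>U\<close> be counted too.\<close>

definition ideal_filtration :: "'v set \<Rightarrow> 'v set \<Rightarrow> nat \<Rightarrow> 'v set" where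
  "ideal_filtration A U k = (case k of 0 \<Rightarrow> A | Suc k \<Rightarrow> right_power U U k)"

lemma ideal_filtration_step:
  assumes "lideal (restr A) U" "subalgebra (restr UNIV) A" "x \<in> ideal_filtration A U k"
  shows "u \<in> U \<Longrightarrow> x \<cdot> u \<in> ideal_filtration A U (Suc k)"
    and "a \<in> A \<Longrightarrow> x \<cdot> a \<in> ideal_filtration A U k"
  using assms right_power_step[of x U U _ u] right_power_right_ideal[OF assms(1)]
  unfolding ideal_filtration_def
  by (auto simp: lideal_restr subalgebra_restr simp del: right_power.simps(2) split: nat.splits)

lemma ideal_filtration_eq_zero:
  assumes "lideal (restr A) U" "right_power U U k \<subseteq> {0}" "x \<in> ideal_filtration A U i" "k < i"
  shows "x = 0"
proof -
  have "x \<in> right_power U U (i - 1)" "k \<le> i - 1"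
    using assms by (auto simp: ideal_filtration_def split: nat.splits)
  moreover have "subspace U" "\<forall>x\<in>U. \<forall>y\<in>U. x \<cdot> y \<in> U" using assms by (auto simp: lideal_restr)
  ultimately show ?thesis using right_power_antimono[of U U k "i - 1"] assms(2) by blast
qed

text \<open>
  A product of \<open>n + 1\<close> factors from \<open>U\<close> or \<open>W\<close> lies in the \<open>i\<close>-th term of the filtration of \<open>U\<close> and in the
  \<open>j\<close>-th term of that of \<open>W\<close>, where \<open>i\<close> and \<open>j\<close> count the factors of each kind.
\<close>

lemma nilpotent_ideal_sum:
  assumes A: "subalgebra (restr UNIV) A" and "nilpotent_ideal A U" "nilpotent_ideal A W"
  shows "nilpotent_ideal A {u + w |u w. u \<in> U \<and> w \<in> W}" (is "nilpotent_ideal A ?S")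
proof -
  have UW: "lideal (restr A) U" "lideal (restr A) W" using assms by (auto simp: nilpotent_ideal_def)
  have S: "lideal (restr A) ?S" using UW A by (intro lideal_sum) (auto simp: subalgebra_restr)
  obtain k l where kl: "right_power U U k \<subseteq> {0}" "right_power W W l \<subseteq> {0}"
    using assms UW[THEN lideal_imp_subalgebra] by (auto simp: nilpotent_ideal_def lnilpotent_restr)
  let ?F = "ideal_filtration A U" and ?G = "ideal_filtration A W"
  \<comment> \<open>The \<open>n\<close>-th term of the series of the sum is spanned by words of
    \<open>n + 1\<close> letters, hence the total \<open>Suc n\<close>.\<close>
  define Z where "Z n = \<Union>{?F i \<inter> ?G j |i j. i + j = Suc n}" for n
  have Z_I: "x \<in> Z n" if "x \<in> ?F i" "x \<in> ?G j" "i + j = Suc n" for x i j n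
    using that unfolding Z_def by blast
  have "right_power ?S ?S n \<subseteq> span (Z n)" for n
  proof (induction n)
    case 0
    show ?case
    proof
      fix x assume "x \<in> right_power ?S ?S 0"
      then obtain u w where uw: "u \<in> U" "w \<in> W" "x = u + w" by auto
      then have "u \<in> ?F 1 \<inter> ?G 0" "w \<in> ?F 0 \<inter> ?G 1"
        using UW by (auto simp: ideal_filtration_def lideal_restr)
      then have "u \<in> Z 0" "w \<in> Z 0" using Z_I[of u 1 0 0] Z_I[of w 0 1 0] by auto
      then show "x \<in> span (Z 0)" using uw by (auto intro: span_add span_base)
    qed
  next
    case (Suc n)
    have "x \<cdot> (u + w) \<in> span (Z (Suc n))" if uw: "u \<in> U" "w \<in> W" and x: "x \<in> span (Z n)" for x u w
    proof -
      have "Z n \<subseteq> {x. x \<cdot> (u + w) \<in> span (Z (Suc n))}"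
      proof
        fix y assume "y \<in> Z n"
        then obtain i j where ij: "y \<in> ?F i" "y \<in> ?G j" "i + j = Suc n" unfolding Z_def by blast
        have "u \<in> A" "w \<in> A" using uw UW by (auto simp: lideal_restr)
        then have "y \<cdot> u \<in> ?F (Suc i) \<inter> ?G j" "y \<cdot> w \<in> ?F i \<inter> ?G (Suc j)"
          using ideal_filtration_step[OF UW(1) A ij(1)] ideal_filtration_step[OF UW(2) A ij(2)] uw by auto
        then have "y \<cdot> u \<in> Z (Suc n)" "y \<cdot> w \<in> Z (Suc n)"
          using Z_I[of "y \<cdot> u" "Suc i" j] Z_I[of "y \<cdot> w" i "Suc j"] ij by auto
        then show "y \<in> {x. x \<cdot> (u + w) \<in> span (Z (Suc n))}"
          by (auto simp: bracket_linear intro: span_add span_base)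
      qed
      from span_minimal[OF this subspace_right_mult_vimage[OF subspace_span]] show ?thesis
        using x by auto
    qed
    then show ?case unfolding right_power.simps(2) using Suc
      by (intro span_minimal subspace_span) blast
  qed
  \<comment> \<open>Here \<open>i + j = k + l + 2\<close> forces \<open>k < i\<close> or
    \<open>l < j\<close>, and either filtration is then zero.\<close>
  moreover have "Z (k + l + 1) \<subseteq> {0}"
  proof
    fix x assume "x \<in> Z (k + l + 1)"
    then obtain i j where ij: "x \<in> ?F i" "x \<in> ?G j" "i + j = Suc (k + l + 1)" unfolding Z_def by blast
    then have "k < i \<or> l < j" by linarith
    then show "x \<in> {0}"
      using ideal_filtration_eq_zero[OF UW(1) kl(1) ij(1)] ideal_filtration_eq_zero[OF UW(2) kl(2) ij(2)] by auto
  qed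
  then have "span (Z (k + l + 1)) \<subseteq> {0}" by (intro span_minimal) auto
  ultimately have "lnilpotent (restr ?S)"
    unfolding lnilpotent_restr[OF lideal_imp_subalgebra[OF S]] by blast
  then show ?thesis using S by (simp add: nilpotent_ideal_def)
qed

text \<open>The higher Leibniz rule without binomial coefficients: one application of the derivation
  to \<open>x \<cdot> y\<close> yields two products, in each of which one of the two exponents has
  dropped by one.\<close>

lemma right_mult_derivation_pow:
  assumes "(right_mult a ^^ m) x = 0" "(right_mult a ^^ n) y = 0"
  shows "(right_mult a ^^ (m + n)) (x \<cdot> y) = 0"
  using assms
proof (induction "m + n" arbitrary: m n x y)
  case (Suc k)
  show ?case
  proof (cases "m = 0 \<or> n = 0")
    case True
    then show ?thesis using Suc.prems by auto
  next
    case False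
    then obtain m' n' where mn: "m = Suc m'" "n = Suc n'" by (meson not0_implies_Suc)
    have "(right_mult a ^^ k) (x \<cdot> a \<cdot> y) = 0" "(right_mult a ^^ k) (x \<cdot> (y \<cdot> a)) = 0"
      using Suc.hyps(1)[of m' n "x \<cdot> a" y] Suc.hyps(1)[of m n' x "y \<cdot> a"] Suc.hyps(2) Suc.prems mn
      by (simp_all add: funpow_Suc_right del: funpow.simps)
    then show ?thesis unfolding Suc.hyps(2)[symmetric] funpow_Suc_right
      by (simp add: bracket_swap_right[of x y a] right_mult_pow_add)
  qed
qed simp

text \<open>The Fitting null component of right multiplication by \<open>a\<close>. Closure under
  products is the derivation property.\<close>

lemma null_component_subalgebra:
  assumes A: "subalgebra (restr UNIV) A"
  shows "subalgebra (restr A) {x \<in> A. \<exists>m. (right_mult a ^^ m) x = 0}" (is "subalgebra _ ?N")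
  unfolding subalgebra_restr
proof safe
  have sA: "subspace A" using A by (simp add: subalgebra_restr)
  show "subspace ?N"
  proof (rule subspaceI)
    show "0 \<in> ?N" using subspace_0[OF sA] by simp
    fix x y assume "x \<in> ?N" "y \<in> ?N"
    then obtain m n where mn: "x \<in> A" "y \<in> A" "(right_mult a ^^ m) x = 0" "(right_mult a ^^ n) y = 0"
      by blast
    then have "(right_mult a ^^ (max m n)) (x + y) = 0"
      by (simp add: right_mult_pow_add right_mult_pow_le[of m a x] right_mult_pow_le[of n a y])
    then show "x + y \<in> ?N" using mn subspace_add[OF sA] by blast
  next
    fix c x assume "x \<in> ?N"
    then obtain m where "x \<in> A" "(right_mult a ^^ m) x = 0" by blast
    then have "(right_mult a ^^ m) (c *s x) = 0" "c *s x \<in> A"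
      using subspace_scale[OF sA] by (simp_all add: right_mult_pow_scale)
    then show "c *s x \<in> ?N" by blast
  qed
next
  fix x y m n assume "x \<in> A" "y \<in> A" "(right_mult a ^^ m) x = 0" "(right_mult a ^^ n) y = 0"
  then show "x \<cdot> y \<in> A" "\<exists>m. (right_mult a ^^ m) (x \<cdot> y) = 0"
    using A right_mult_derivation_pow[of m a x n y] by (auto simp add: subalgebra_restr)
qed

end

section \<open>Greatest ideals, Fitting's lemma and the Frattini ideal\<close>

context fd_leibniz_algebra
begin

text \<open>A member \<open>U\<close> of largest dimension absorbs every other \<open>W\<close>,
  because the sum of the two is again a member and cannot be larger. This shows that
  \<open>GREATEST\<close> is attained for the nilradical and the Frattini ideal.\<close>

lemma greatest_subspace:
  assumes "P U0" and sub: "\<And>U. P U \<Longrightarrow> subspace U"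
    and sum: "\<And>U W. P U \<Longrightarrow> P W \<Longrightarrow> P {u + w |u w. u \<in> U \<and> w \<in> W}"
  shows "P (Greatest P)" and "P W \<Longrightarrow> W \<subseteq> Greatest P"
proof -
  obtain U where U: "P U" "\<And>W. P W \<Longrightarrow> dim W \<le> dim U"
    using exists_max_subspace assms(1) by blast
  have greatest: "W \<subseteq> U" if W: "P W" for W
  proof -
    let ?S = "{u + w |u w. u \<in> U \<and> w \<in> W}"
    have "U \<subseteq> ?S" using subspace_0[OF sub[OF W]] by force
    then have "U = ?S" using sum[OF U(1) W] sub U by (intro subspace_dim_equal) auto
    moreover have "W \<subseteq> ?S" using subspace_0[OF sub[OF U(1)]] by force
    ultimately show ?thesis by blast
  qed
  then have "Greatest P = U" using U(1) by (rule Greatest_equality[rotated])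
  then show "P (Greatest P)" "P W \<Longrightarrow> W \<subseteq> Greatest P" using U(1) greatest by auto
qed

lemma
  assumes A: "subalgebra (restr UNIV) A"
  shows nilpotent_ideal_nilradical: "nilpotent_ideal A (nilradical (restr A))"
    and nilpotent_ideal_subset_nilradical: "nilpotent_ideal A W \<Longrightarrow> W \<subseteq> nilradical (restr A)"
proof -
  have eq: "nilradical (restr A) = Greatest (nilpotent_ideal A)"
    by (simp add: nilradical_def nilpotent_ideal_def[abs_def])
  have z: "lideal (restr A) {0}"
    using A subspace_0 by (auto simp: lideal_restr subalgebra_restr)
  have "right_power {0} {0} 0 \<subseteq> {0}" by simp
  then have "nilpotent_ideal A {0}"
    using z lnilpotent_restr[OF lideal_imp_subalgebra[OF z]] unfolding nilpotent_ideal_def by blast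
  note * = greatest_subspace[of "nilpotent_ideal A", OF this _ nilpotent_ideal_sum[OF A]]
  show "nilpotent_ideal A (nilradical (restr A))" "nilpotent_ideal A W \<Longrightarrow> W \<subseteq> nilradical (restr A)"
    unfolding eq by (rule *; simp add: nilpotent_ideal_def lideal_restr)+
qed

lemma frattini_ideal_subset_maximal:
  assumes A: "subalgebra (restr UNIV) A" and M: "maximal_subalgebra (restr A) M"
  shows "frattini_ideal (restr A) \<subseteq> M"
proof -
  let ?P = "\<lambda>U. lideal (restr A) U \<and> (\<forall>M. maximal_subalgebra (restr A) M \<longrightarrow> U \<subseteq> M)"
  have sA: "subspace A" using A by (simp add: subalgebra_restr)
  have sM: "subspace M" if "maximal_subalgebra (restr A) M" for M
    using that by (simp add: maximal_subalgebra_def subalgebra_restr)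
  have "?P (Greatest ?P)"
  proof (rule greatest_subspace)
    show "?P {0}" using subspace_0[OF sA] subspace_0[OF sM] by (auto simp: lideal_restr)
    show "subspace U" if "?P U" for U using that by (simp add: lideal_restr)
    show "?P {u + w |u w. u \<in> U \<and> w \<in> W}" if "?P U" "?P W" for U W
      using that lideal_sum[OF _ _ sA, of U W] subspace_add[OF sM] by blast
  qed
  then show ?thesis using M by (simp add: frattini_ideal_def)
qed

text \<open>Among the proper subalgebras containing \<open>M\<close>, one of largest dimension is
  maximal.\<close>

lemma exists_maximal_subalgebra:
  assumes "subspace A" "subalgebra (restr A) M" "M \<noteq> A"
  obtains M' where "maximal_subalgebra (restr A) M'" "M \<subseteq> M'"
proof -
  let ?P = "\<lambda>U. subalgebra (restr A) U \<and> U \<noteq> A \<and> M \<subseteq> U"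
  obtain U where U: "?P U" "\<And>W. ?P W \<Longrightarrow> dim W \<le> dim U"
    using exists_max_subspace[of ?P M] assms by blast
  have "W = U \<or> W = A" if "subalgebra (restr A) W" "U \<subseteq> W" for W
  proof (rule disjCI)
    assume "W \<noteq> A"
    then have "dim W \<le> dim U" using that U by blast
    then show "W = U" using that U subspace_dim_equal[of U W] by (simp add: subalgebra_restr)
  qed
  then have "maximal_subalgebra (restr A) U" using U by (simp add: maximal_subalgebra_def)
  then show ?thesis using U that by blast
qed

text \<open>The images of the powers stabilise once their dimension is least. Then the
  \<open>m\<close>-th power of \<open>x\<close> is also the \<open>2m\<close>-th power of some
  \<open>y\<close>, and subtracting the image of \<open>y\<close> leaves a null vector. The bound
  \<open>k\<close> allows the image part to be placed in the Frattini ideal.\<close>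

lemma fitting:
  assumes V: "subspace V" and Va: "\<forall>v\<in>V. v \<cdot> a \<in> V"
  shows "\<exists>m\<ge>k. \<forall>x\<in>V. \<exists>y\<in>V. (right_mult a ^^ m) (x - (right_mult a ^^ m) y) = 0"
proof -
  let ?R = "\<lambda>m. right_mult a ^^ m"
  obtain m0 where m0: "\<And>n. dim (?R m0 ` V) \<le> dim (?R n ` V)"
    using ex_has_least_nat[of "\<lambda>_. True" 0 "\<lambda>n. dim (?R n ` V)"] by blast
  have im: "?R m ` V = ?R m0 ` V" if "m0 \<le> m" for m
  proof (rule subspace_dim_equal)
    have "?R m x \<in> ?R m0 ` V" if "x \<in> V" for x
    proof -
      have "?R m x = ?R m0 (?R (m - m0) x)"
        using \<open>m0 \<le> m\<close> by (metis comp_apply funpow_add le_add_diff_inverse)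
      moreover have "?R (m - m0) x \<in> V" using Va that by (intro right_mult_pow_mem) auto
      ultimately show ?thesis by blast
    qed
    then show "?R m ` V \<subseteq> ?R m0 ` V" by blast
  qed (use m0 subspace_right_mult_pow_image[OF V] in auto)
  let ?m = "max k m0"
  have "\<exists>y\<in>V. ?R ?m (x - ?R ?m y) = 0" if "x \<in> V" for x
  proof -
    have "?R ?m ` V = ?R (?m + ?m) ` V" using im[of ?m] im[of "?m + ?m"] by simp
    then have "?R ?m x \<in> ?R (?m + ?m) ` V" using that by (metis imageI)
    then obtain y where "y \<in> V" "?R ?m x = ?R (?m + ?m) y" by (elim imageE)
    then show ?thesis by (auto simp: right_mult_pow_diff funpow_add)
  qed
  then show ?thesis by (intro exI[of _ ?m]) auto
qed

text \<open>The kernels of the powers increase, so the one of largest dimension contains all of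
  them. This turns pointwise nilpotency into the uniform exponent that \<open>engel\<close> asks
  for.\<close>

lemma right_mult_nilpotent_uniform:
  assumes V: "subspace V" and nil: "\<forall>v\<in>V. \<exists>m. (right_mult a ^^ m) v = 0"
  shows "\<exists>m. \<forall>v\<in>V. (right_mult a ^^ m) v = 0"
proof -
  let ?K = "\<lambda>m. {v \<in> V. (right_mult a ^^ m) v = 0}"
  have sK: "subspace (?K m)" for m
    by (rule subspaceI) (simp_all add: subspace_0[OF V] subspace_add[OF V] subspace_scale[OF V]
        right_mult_pow_add right_mult_pow_scale)
  obtain m where m: "\<And>n. dim (?K n) \<le> dim (?K m)"
    using ex_has_greatest_nat[of "\<lambda>_. True" 0 "\<lambda>n. dim (?K n)" "Suc dimension"]
    by (auto simp: less_Suc_eq_le dim_subset_UNIV)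
  have "(right_mult a ^^ m) v = 0" if v: "v \<in> V" for v
  proof -
    obtain n where n: "(right_mult a ^^ n) v = 0" using nil v by blast
    have "?K m = ?K (m + n)"
      using sK m by (intro subspace_dim_equal) (auto intro: right_mult_pow_le)
    moreover have "v \<in> ?K (m + n)" using v n by (auto intro: right_mult_pow_le)
    ultimately show ?thesis by blast
  qed
  then show ?thesis by blast
qed

text \<open>If the null component were proper, a maximal subalgebra \<open>M\<close> would contain
  it together with the Frattini ideal; Fitting's lemma writes each element of \<open>A\<close> as a
  sum from these two, so \<open>M = A\<close>.\<close>

lemma right_mult_nilpotent_mod_frattini:
  assumes A: "subalgebra (restr UNIV) A" and a: "a \<in> A"
    and k: "\<forall>x\<in>A. (right_mult a ^^ k) x \<in> frattini_ideal (restr A)"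
  shows "\<forall>x\<in>A. \<exists>m. (right_mult a ^^ m) x = 0"
proof (rule ccontr)
  let ?N = "{x \<in> A. \<exists>m. (right_mult a ^^ m) x = 0}"
  assume "\<not> ?thesis"
  then have "?N \<noteq> A" by blast
  have sA: "subspace A" and Aa: "\<forall>v\<in>A. v \<cdot> a \<in> A" using A a by (auto simp: subalgebra_restr)
  obtain M where M: "maximal_subalgebra (restr A) M" "?N \<subseteq> M"
    using exists_maximal_subalgebra[OF sA null_component_subalgebra[OF A] \<open>?N \<noteq> A\<close>] .
  have sM: "subspace M" "M \<subseteq> A" "M \<noteq> A" using M by (auto simp: maximal_subalgebra_def subalgebra_restr)
  obtain m where m: "m \<ge> k" "\<forall>x\<in>A. \<exists>y\<in>A. (right_mult a ^^ m) (x - (right_mult a ^^ m) y) = 0"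
    using fitting[OF sA Aa] by blast
  have "x \<in> M" if x: "x \<in> A" for x
  proof -
    obtain y where y: "y \<in> A" "(right_mult a ^^ m) (x - (right_mult a ^^ m) y) = 0" using m x by blast
    have "(right_mult a ^^ m) y = (right_mult a ^^ k) ((right_mult a ^^ (m - k)) y)"
      using m by (metis comp_apply funpow_add le_add_diff_inverse)
    moreover have "(right_mult a ^^ (m - k)) y \<in> A" using Aa y by (intro right_mult_pow_mem) auto
    ultimately have "(right_mult a ^^ m) y \<in> M"
      using k frattini_ideal_subset_maximal[OF A M(1)] by auto
    moreover from this have "x - (right_mult a ^^ m) y \<in> A"
      using x sM(2) by (intro subspace_diff[OF sA]) auto
    then have "x - (right_mult a ^^ m) y \<in> M" using M(2) y(2) by auto
    ultimately show ?thesis using subspace_add[OF sM(1)] by (metis diff_add_cancel)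
  qed
  then show False using sM by blast
qed

lemma ideal_nilpotent_mod_frattini:
  assumes A: "subalgebra (restr UNIV) A" and C: "lideal (restr A) C"
    and k: "right_power C C k \<subseteq> frattini_ideal (restr A)"
  shows "nilpotent_ideal A C"
proof -
  note C' = lideal_imp_subalgebra[OF C]
  have "\<exists>m. \<forall>v\<in>C. (right_mult c ^^ m) v = 0" if c: "c \<in> C" for c
  proof (rule right_mult_nilpotent_uniform)
    \<comment> \<open>One application moves \<open>A\<close> into the ideal \<open>C\<close>; the
      other \<open>k\<close> descend its lower central series.\<close>
    have "(right_mult c ^^ Suc k) x \<in> frattini_ideal (restr A)" if "x \<in> A" for x
    proof -
      have "x \<cdot> c \<in> C" using C c that by (auto simp: lideal_restr)
      then have "(right_mult c ^^ k) (x \<cdot> c) \<in> right_power C C k"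
        using c by (intro right_mult_pow_in_right_power)
      then show ?thesis using k by (auto simp: funpow_Suc_right simp del: funpow.simps)
    qed
    moreover have "c \<in> A" using C c by (auto simp: lideal_restr)
    ultimately have "\<forall>x\<in>A. \<exists>m. (right_mult c ^^ m) x = 0"
      by (intro right_mult_nilpotent_mod_frattini[OF A, of c "Suc k"]) auto
    then show "\<forall>v\<in>C. \<exists>m. (right_mult c ^^ m) v = 0" using C by (auto simp: lideal_restr)
  qed (use C' in \<open>simp add: subalgebra_restr\<close>)
  then have "\<exists>n. right_power C C n \<subseteq> {0}"
    using C' by (intro engel) (auto simp: subalgebra_restr)
  then show ?thesis using C C' by (simp add: nilpotent_ideal_def lnilpotent_restr)
qed

end

subsection \<open>The quotient by an ideal\<close>

context leibniz_algebra
begin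

text \<open>Products with a kernel element on the right vanish because those with squares do;
  products with it on the left are again combinations of squares.\<close>

lemma lideal_leibniz_kernel: "lideal (restr UNIV) (leibniz_kernel (restr UNIV))"
  and bracket_leibniz_kernel: "i \<in> leibniz_kernel (restr UNIV) \<Longrightarrow> x \<cdot> i = 0"
proof -
  let ?S = "{x \<cdot> x |x. True}"
  have eq: "leibniz_kernel (restr UNIV) = span ?S"
    by (simp add: leibniz_kernel_def lspan_restr)
  have zero: "x \<cdot> i = 0" if "i \<in> span ?S" for x i
    using that by (induction rule: span_induct_alt) (auto simp: bracket_linear bracket_square_right)
  have "?S \<subseteq> {z. z \<cdot> y \<in> span ?S}" for y
  proof safe
    fix x
    \<comment> \<open>In the expanded square the mixed terms are
      \<open>x \<cdot> (x \<cdot> y)\<close> and \<open>x \<cdot> y \<cdot> x\<close>, whose sum is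
      \<open>x \<cdot> x \<cdot> y\<close> by the Leibniz identity.\<close>
    have "x \<cdot> x \<cdot> y = (x + x \<cdot> y) \<cdot> (x + x \<cdot> y) - x \<cdot> x - x \<cdot> y \<cdot> (x \<cdot> y)"
      by (simp add: bracket_linear leibniz_identity[of x x y])
    moreover have "z \<cdot> z \<in> span ?S" for z by (rule span_base) blast
    ultimately show "x \<cdot> x \<cdot> y \<in> span ?S" by (simp only: span_diff)
  qed
  then have "span ?S \<subseteq> {z. z \<cdot> y \<in> span ?S}" for y
    by (intro span_minimal subspace_right_mult_vimage subspace_span)
  then show "lideal (restr UNIV) (leibniz_kernel (restr UNIV))"
    unfolding eq lideal_restr by (auto simp: zero span_zero)
  show "i \<in> leibniz_kernel (restr UNIV) \<Longrightarrow> x \<cdot> i = 0" unfolding eq by (rule zero)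
qed

text \<open>Every product with a factor from \<open>I\<close> stays in \<open>I\<close>, so modulo
  \<open>I\<close> only the words in \<open>U\<close> remain.\<close>

lemma right_power_ideal_sum_subset:
  assumes I: "lideal (restr UNIV) I" and U: "subspace U"
  shows "right_power {i + u |i u. i \<in> I \<and> u \<in> U} {i + u |i u. i \<in> I \<and> u \<in> U} k
    \<subseteq> {i + x |i x. i \<in> I \<and> x \<in> right_power U U k}" (is "right_power ?S ?S k \<subseteq> ?T k")
proof (induction k)
  case (Suc k)
  have sT: "subspace (?T (Suc k))"
    using I by (intro subspace_sums subspace_right_power U) (simp add: lideal_restr)
  show ?case unfolding right_power.simps(2)[of ?S]
  proof (rule span_minimal[OF _ sT], safe)
    fix x j v assume "x \<in> right_power ?S ?S k" and jv: "j \<in> I" "v \<in> U"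
    with Suc obtain i y where iy: "i \<in> I" "y \<in> right_power U U k" "x = i + y" by blast
    have "x \<cdot> (j + v) = (i \<cdot> (j + v) + y \<cdot> j) + y \<cdot> v"
      using iy by (simp add: bracket_linear)
    moreover have "i \<cdot> (j + v) + y \<cdot> j \<in> I"
      using I iy jv subspace_add[of I] by (simp add: lideal_restr)
    ultimately show "\<exists>i' y'. x \<cdot> (j + v) = i' + y' \<and> i' \<in> I \<and> y' \<in> right_power U U (Suc k)"
      using right_power_step[OF iy(2) jv(2)] by blast
  qed
qed simp

section \<open>Correspondence between the quotient and preimages in the algebra\<close>

context
  fixes I assumes I: "lideal (restr UNIV) I"
begin

abbreviation coset :: "'v \<Rightarrow> 'v set" where
  "coset \<equiv> lcoset (restr UNIV) I"

text \<open>The carrier is the image \<open>(W + I)/I\<close>; \<open>W\<close> itself need not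
  contain \<open>I\<close>.\<close>

abbreviation quotient :: "'v set \<Rightarrow> ('f, 'v set) lstruct" where
  "quotient W \<equiv> (lquotient (restr UNIV) I)\<lparr>lcarrier := coset ` W\<rparr>"

lemma subspace_I: "subspace I"
  using I by (simp add: lideal_restr)

lemma mem_coset_iff: "y \<in> coset x \<longleftrightarrow> y - x \<in> I"
proof
  assume "y - x \<in> I"
  then show "y \<in> coset x" by (auto simp: lcoset_def intro!: exI[of _ "y - x"])
qed (auto simp: lcoset_def)

lemma coset_refl: "x \<in> coset x"
  by (simp add: mem_coset_iff subspace_0[OF subspace_I])

lemma coset_eq_iff: "coset x = coset y \<longleftrightarrow> x - y \<in> I"
proof
  assume "x - y \<in> I"
  then have "z - x \<in> I \<longleftrightarrow> z - y \<in> I" for z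
    using subspace_add[OF subspace_I, of "z - x" "x - y"] subspace_diff[OF subspace_I, of "z - y" "x - y"]
    by auto
  then show "coset x = coset y" by (auto simp: mem_coset_iff)
qed (use coset_refl mem_coset_iff in blast)

lemma coset_0: "coset 0 = I"
  by (auto simp: mem_coset_iff)

lemma coset_eq_kernel_iff: "coset x = I \<longleftrightarrow> x \<in> I"
  using coset_eq_iff[of x 0] by (simp add: coset_0)

lemma lcarrier_quotient: "lcarrier (quotient W) = coset ` W"
  by simp

text \<open>For all representatives the results lie in one coset, so each union over the nonempty
  cosets collapses. For the bracket this uses that \<open>I\<close> is two-sided.\<close>

lemma lquotient_simps [simp]:
  "lzero (lquotient (restr UNIV) I) = I"
  "ladd (lquotient (restr UNIV) I) (coset x) (coset y) = coset (x + y)"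
  "lscale (lquotient (restr UNIV) I) c (coset x) = coset (c *s x)"
  "lbracket (lquotient (restr UNIV) I) (coset x) (coset y) = coset (x \<cdot> y)"
proof -
  have ne: "coset z \<noteq> {}" for z using coset_refl by blast
  have "coset (u + v) = coset (x + y)" if "u \<in> coset x" "v \<in> coset y" for u v
    using that subspace_add[OF subspace_I, of "u - x" "v - y"]
    unfolding mem_coset_iff coset_eq_iff by (simp add: algebra_simps)
  then have "(\<Union>u\<in>coset x. \<Union>v\<in>coset y. coset (u + v)) = (\<Union>u\<in>coset x. \<Union>v\<in>coset y. coset (x + y))"
    by (intro SUP_cong refl)
  then show "ladd (lquotient (restr UNIV) I) (coset x) (coset y) = coset (x + y)"
    by (simp add: lquotient_def ne)
  have "coset (c *s u) = coset (c *s x)" if "u \<in> coset x" for u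
    using that subspace_scale[OF subspace_I, of "u - x" c]
    unfolding mem_coset_iff coset_eq_iff by (simp add: scale_right_diff_distrib)
  then have "(\<Union>u\<in>coset x. coset (c *s u)) = (\<Union>u\<in>coset x. coset (c *s x))"
    by (intro SUP_cong refl)
  then show "lscale (lquotient (restr UNIV) I) c (coset x) = coset (c *s x)"
    by (simp add: lquotient_def ne)
  have "coset (u \<cdot> v) = coset (x \<cdot> y)" if "u \<in> coset x" "v \<in> coset y" for u v
  proof -
    have "u \<cdot> v - x \<cdot> y = (u - x) \<cdot> v + x \<cdot> (v - y)" by (simp add: bracket_linear)
    also have "\<dots> \<in> I"
      using that I by (intro subspace_add[OF subspace_I]) (simp_all add: mem_coset_iff lideal_restr)
    finally show ?thesis by (simp add: coset_eq_iff)
  qed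
  then have "(\<Union>u\<in>coset x. \<Union>v\<in>coset y. coset (u \<cdot> v)) = (\<Union>u\<in>coset x. \<Union>v\<in>coset y. coset (x \<cdot> y))"
    by (intro SUP_cong refl)
  then show "lbracket (lquotient (restr UNIV) I) (coset x) (coset y) = coset (x \<cdot> y)"
    by (simp add: lquotient_def ne)
qed (simp add: lquotient_def)

lemma lquotient_eq_quotient: "lquotient (restr UNIV) I = quotient UNIV"
  by (simp add: lquotient_def)

text \<open>Coset operations act on representatives, so closure of \<open>X\<close> is closure of
  its full preimage; questions about the quotient thereby return to \<open>subspace\<close>.\<close>

lemma lsubspace_quotient:
  "lsubspace (quotient W) X \<longleftrightarrow> X \<subseteq> coset ` W \<and> subspace {x. coset x \<in> X}" (is "?l \<longleftrightarrow> ?r")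
proof
  assume X: ?l
  have "subspace {x. coset x \<in> X}"
  proof (rule subspaceI)
    show "0 \<in> {x. coset x \<in> X}" using X by (simp add: lsubspace_def coset_0)
    show "x + y \<in> {x. coset x \<in> X}" if "x \<in> {x. coset x \<in> X}" "y \<in> {x. coset x \<in> X}" for x y
      using X that by (auto simp: lsubspace_def simp flip: lquotient_simps(2))
    show "c *s x \<in> {x. coset x \<in> X}" if "x \<in> {x. coset x \<in> X}" for c x
      using X that by (auto simp: lsubspace_def simp flip: lquotient_simps(3))
  qed
  then show ?r using X by (simp add: lsubspace_def)
next
  assume X: ?r
  note P = conjunct2[OF X]
  have rep: "\<exists>y. x = coset y" if "x \<in> X" for x using X that by blast
  show ?l unfolding lsubspace_def
  proof (intro conjI ballI allI)
    show "lzero (quotient W) \<in> X" using subspace_0[OF P] by (simp add: coset_0)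
    show "ladd (quotient W) x y \<in> X" if xy: "x \<in> X" "y \<in> X" for x y
      using rep[OF xy(1)] rep[OF xy(2)] subspace_add[OF P] xy by auto
    show "lscale (quotient W) c x \<in> X" if x: "x \<in> X" for c x
      using rep[OF x] subspace_scale[OF P] x by auto
  qed (use X in simp)
qed

lemma lspan_quotient:
  assumes W: "subspace W" and S: "S \<subseteq> W"
  shows "lspan (quotient W) (coset ` S) = coset ` span S"
proof
  have "coset ` span S \<subseteq> coset ` W" using span_minimal[OF S W] by blast
  moreover have "subspace {x. coset x \<in> coset ` span S}"
  proof -
    \<comment> \<open>The full preimage of the image of \<open>span S\<close> is
      \<open>I + span S\<close>.\<close>
    have "{x. coset x \<in> coset ` span S} = {i + s |i s. i \<in> I \<and> s \<in> span S}"
    proof safe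
      fix x s assume "coset x = coset s" "s \<in> span S"
      then show "\<exists>i t. x = i + t \<and> i \<in> I \<and> t \<in> span S"
        by (intro exI[of _ "x - s"] exI[of _ s]) (simp add: coset_eq_iff)
    next
      fix i s assume "i \<in> I" "s \<in> span S"
      then have "coset (i + s) = coset s" by (simp add: coset_eq_iff)
      then show "coset (i + s) \<in> coset ` span S" using \<open>s \<in> span S\<close> by simp
    qed
    then show ?thesis using subspace_sums[OF subspace_I subspace_span] by simp
  qed
  ultimately have "lsubspace (quotient W) (coset ` span S)" by (simp add: lsubspace_quotient)
  then show "lspan (quotient W) (coset ` S) \<subseteq> coset ` span S"
    using span_superset unfolding lspan_def by blast
  have "coset ` span S \<subseteq> U" if "lsubspace (quotient W) U" "coset ` S \<subseteq> U" for U
    using span_minimal[of S "{x. coset x \<in> U}"] that by (auto simp: lsubspace_quotient)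
  then show "coset ` span S \<subseteq> lspan (quotient W) (coset ` S)" unfolding lspan_def by blast
qed

lemma lower_central_quotient:
  assumes C: "subalgebra (restr UNIV) C"
  shows "lower_central (quotient C) k = coset ` right_power C C k"
proof (induction k)
  case (Suc k)
  let ?R = "right_power C C k"
  have "?R \<subseteq> C" using right_power_antimono[of C C 0 k] C by (auto simp: subalgebra_restr)
  then have sub: "{x \<cdot> c |x c. x \<in> ?R \<and> c \<in> C} \<subseteq> C" using C by (auto simp: subalgebra_restr)
  have "{lbracket (quotient C) x y |x y. x \<in> coset ` ?R \<and> y \<in> coset ` C}
      = coset ` {x \<cdot> c |x c. x \<in> ?R \<and> c \<in> C}"
  proof safe
    fix x c assume "x \<in> ?R" "c \<in> C"
    then show "lbracket (quotient C) (coset x) (coset c) \<in> coset ` {x \<cdot> c |x c. x \<in> ?R \<and> c \<in> C}"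
      by auto
    show "\<exists>x' y. coset (x \<cdot> c) = lbracket (quotient C) x' y \<and> x' \<in> coset ` ?R \<and> y \<in> coset ` C"
      using \<open>x \<in> ?R\<close> \<open>c \<in> C\<close> by (intro exI[of _ "coset x"] exI[of _ "coset c"]) auto
  qed
  moreover have "subspace C" using C by (simp add: subalgebra_restr)
  ultimately show ?case
    unfolding lower_central.simps lprod_def Suc lcarrier_quotient right_power.simps(2)
    using lspan_quotient[OF _ sub] by simp
qed simp

lemma lnilpotent_quotient:
  assumes C: "subalgebra (restr UNIV) C"
  shows "lnilpotent (quotient C) \<longleftrightarrow> (\<exists>k. right_power C C k \<subseteq> I)"
proof -
  have "coset ` right_power C C k = {I} \<longleftrightarrow> right_power C C k \<subseteq> I" for k
  proof -
    have "0 \<in> right_power C C k"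
      using C by (intro subspace_0 subspace_right_power) (simp add: subalgebra_restr)
    then have "I \<in> coset ` right_power C C k" using coset_0 by (metis imageI)
    then have "coset ` right_power C C k = {I} \<longleftrightarrow> coset ` right_power C C k \<subseteq> {I}"
      by (metis subset_singletonD empty_iff subset_refl)
    also have "\<dots> \<longleftrightarrow> right_power C C k \<subseteq> I"
      by (simp only: image_subset_iff singleton_iff coset_eq_kernel_iff subset_eq[of _ I])
    finally show ?thesis .
  qed
  then show ?thesis by (simp add: lnilpotent_def lower_central_quotient[OF C])
qed

lemma lideal_quotient:
  "lideal (quotient UNIV) X \<longleftrightarrow> X \<subseteq> range coset \<and> lideal (restr UNIV) {x. coset x \<in> X}"
    (is "?l \<longleftrightarrow> ?r")
proof
  assume X: ?l
  have "coset (u \<cdot> a) \<in> X \<and> coset (a \<cdot> u) \<in> X" if "coset u \<in> X" for u a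
    using X that by (auto simp: lideal_def simp flip: lquotient_simps(4))
  then show ?r using X unfolding lideal_restr by (simp add: lideal_def lsubspace_quotient)
next
  assume X: ?r
  then have "lbracket (quotient UNIV) u a \<in> X \<and> lbracket (quotient UNIV) a u \<in> X"
    if "u \<in> X" "a \<in> range coset" for u a
    using that X by (auto simp: lideal_restr)
  moreover have "lsubspace (quotient UNIV) X" using X by (simp add: lsubspace_quotient lideal_restr)
  ultimately show ?l unfolding lideal_def lcarrier_quotient by simp
qed

lemma coset_image_vimage: "X \<subseteq> range coset \<Longrightarrow> coset ` {x. coset x \<in> X} = X"
  by auto

lemma coset_mem_image_iff:
  assumes "subspace N" "I \<subseteq> N" shows "coset x \<in> coset ` N \<longleftrightarrow> x \<in> N"
proof
  assume "coset x \<in> coset ` N"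
  then obtain n where "n \<in> N" "x - n \<in> N" using assms by (auto simp: coset_eq_iff)
  then show "x \<in> N" using subspace_add[OF assms(1)] by (metis diff_add_cancel)
qed simp

text \<open>Full preimages match the ideals of the quotient with the ideals \<open>C\<close>
  containing \<open>I\<close>, and nilpotency becomes descent of the series of \<open>C\<close> into
  \<open>I\<close>. The greatest such \<open>C\<close> is thus the preimage of the
  nilradical.\<close>

lemma nilradical_quotient_eqI:
  assumes N: "lideal (restr UNIV) N" "I \<subseteq> N" "right_power N N k \<subseteq> I"
    and greatest: "\<And>C l. lideal (restr UNIV) C \<Longrightarrow> I \<subseteq> C \<Longrightarrow> right_power C C l \<subseteq> I \<Longrightarrow> C \<subseteq> N"
  shows "nilradical (lquotient (restr UNIV) I) = coset ` N"
proof (subst lquotient_eq_quotient, unfold nilradical_def, rule Greatest_equality)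
  have "subspace N" using N(1) by (simp add: lideal_restr)
  then have "{x. coset x \<in> coset ` N} = N"
    by (simp add: coset_mem_image_iff[OF _ N(2)])
  then have "lideal (quotient UNIV) (coset ` N)" using N(1) by (simp add: lideal_quotient image_mono)
  moreover have "lnilpotent (quotient N)"
    using N(3) lnilpotent_quotient[OF lideal_imp_subalgebra[OF N(1)]] by blast
  ultimately show "lideal (quotient UNIV) (coset ` N) \<and> lnilpotent (quotient UNIV\<lparr>lcarrier := coset ` N\<rparr>)"
    by simp
next
  fix X assume X: "lideal (quotient UNIV) X \<and> lnilpotent (quotient UNIV\<lparr>lcarrier := X\<rparr>)"
  let ?C = "{x. coset x \<in> X}"
  have C: "lideal (restr UNIV) ?C" and im: "coset ` ?C = X"
    using X coset_image_vimage by (auto simp: lideal_quotient)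
  have "I \<in> X" using subspace_0[of ?C] C by (auto simp: lideal_restr coset_0)
  then have "I \<subseteq> ?C" using coset_eq_kernel_iff[THEN iffD2] by auto
  moreover have "lnilpotent (quotient ?C)" using X im by simp
  then obtain l where "right_power ?C ?C l \<subseteq> I"
    using lnilpotent_quotient[OF lideal_imp_subalgebra[OF C]] by blast
  ultimately have "?C \<subseteq> N" using greatest[OF C] by blast
  then show "X \<subseteq> coset ` N" using im by blast
qed

end

end

section \<open>The nilradical modulo the Leibniz kernel\<close>

context fd_leibniz_algebra
begin

lemma
  fixes B defines "I \<equiv> leibniz_kernel (restr UNIV)" and "N \<equiv> nilradical (restr B)"
  assumes B: "subalgebra (restr UNIV) B" and IB: "UNIV = lsum (restr UNIV) I B"
    and Fr: "I \<inter> B \<subseteq> frattini_ideal (restr B)"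
  shows nilradical_quotient_leibniz_kernel:
      "nilradical (lquotient (restr UNIV) I) = lcoset (restr UNIV) I ` lsum (restr UNIV) I N"
    and nilradical_quotient_leibniz_kernel_eq_iff:
      "nilradical (lquotient (restr UNIV) I) = lcoset (restr UNIV) I ` nilradical (restr UNIV)
        \<longleftrightarrow> (\<forall>n\<in>N. \<exists>k. \<forall>y\<in>I. (right_mult n ^^ k) y = 0)"
proof -
  let ?S = "{i + n |i n. i \<in> I \<and> n \<in> N}"
  have lsum: "lsum (restr UNIV) I X = {i + x |i x. i \<in> I \<and> x \<in> X}" for X
    by (simp add: lsum_def)
  have decomp: "\<exists>i b. i \<in> I \<and> b \<in> B \<and> x = i + b" for x using IB unfolding lsum by blast
  have I: "lideal (restr UNIV) I" unfolding I_def by (rule lideal_leibniz_kernel)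
  have xI: "x \<cdot> i = 0" if "i \<in> I" for x i using that unfolding I_def by (rule bracket_leibniz_kernel)
  have sI: "subspace I" using I by (simp add: lideal_restr)
  have N: "lideal (restr B) N"
    using nilpotent_ideal_nilradical[OF B] by (simp add: N_def nilpotent_ideal_def)
  then have sN: "subspace N" by (simp add: lideal_restr)
  obtain k where k: "right_power N N k \<subseteq> {0}"
    using nilpotent_ideal_nilradical[OF B] lnilpotent_restr[OF lideal_imp_subalgebra[OF N]]
    unfolding N_def nilpotent_ideal_def by blast
  have IS: "I \<subseteq> ?S" using subspace_0[OF sN] by force
  \<comment> \<open>Write the other factor as \<open>j + b\<close>. Right factors from
    \<open>I\<close> give zero, so besides products inside \<open>B\<close> only
    \<open>i \<cdot> x\<close> and \<open>j \<cdot> n\<close> occur, and these lie in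
    \<open>I\<close>.\<close>
  have S: "lideal (restr UNIV) ?S" unfolding lideal_restr
  proof (intro conjI ballI)
    show "subspace ?S" by (intro subspace_sums sI sN)
    fix s x assume "s \<in> ?S"
    then obtain i n where s: "i \<in> I" "n \<in> N" "s = i + n" by blast
    obtain j b where x: "j \<in> I" "b \<in> B" "x = j + b" using decomp by blast
    have "s \<cdot> x = i \<cdot> x + n \<cdot> b" "x \<cdot> s = j \<cdot> n + b \<cdot> n"
      using s x by (simp_all add: bracket_linear xI)
    moreover have "i \<cdot> x \<in> I" "j \<cdot> n \<in> I" using I s x by (simp_all add: lideal_restr)
    moreover have "n \<cdot> b \<in> N" "b \<cdot> n \<in> N" using N s x by (simp_all add: lideal_restr)
    ultimately show "s \<cdot> x \<in> ?S" "x \<cdot> s \<in> ?S" by blast+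
  qed simp
  have Sk: "right_power ?S ?S k \<subseteq> I"
  proof -
    have "{i + x |i x. i \<in> I \<and> x \<in> right_power N N k} \<subseteq> I" using k by auto
    then show ?thesis using right_power_ideal_sum_subset[OF I sN, of k] by (rule subset_trans[rotated])
  qed
  \<comment> \<open>The series of \<open>C \<inter> B\<close> descends into
    \<open>I \<inter> B\<close>, hence into the Frattini ideal of \<open>B\<close>, so
    \<open>C \<inter> B\<close> is a nilpotent ideal of \<open>B\<close>. As
    \<open>I \<subseteq> C\<close>, the \<open>B\<close>-component of an element of \<open>C\<close>
    lies in it.\<close>
  have greatest: "C \<subseteq> ?S" if C: "lideal (restr UNIV) C" "I \<subseteq> C" "right_power C C l \<subseteq> I" for C l
  proof
    let ?D = "C \<inter> B"
    have D: "lideal (restr B) ?D"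
      using C(1) B by (auto simp: lideal_restr subalgebra_restr subspace_inter)
    have "right_power ?D ?D l \<subseteq> ?D"
      using right_power_antimono[of ?D ?D 0 l] D by (auto simp: lideal_restr)
    moreover have "right_power ?D ?D l \<subseteq> right_power C C l" by (intro right_power_mono) auto
    ultimately have "right_power ?D ?D l \<subseteq> frattini_ideal (restr B)" using C(3) Fr by blast
    then have "?D \<subseteq> N" unfolding N_def
      by (intro nilpotent_ideal_subset_nilradical[OF B] ideal_nilpotent_mod_frattini[OF B D])
    fix c assume c: "c \<in> C"
    obtain i b where ib: "i \<in> I" "b \<in> B" "c = i + b" using decomp by blast
    then have "c - i \<in> C" using C c by (intro subspace_diff) (auto simp: lideal_restr)
    then have "b \<in> N" using ib \<open>?D \<subseteq> N\<close> by auto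
    then show "c \<in> ?S" using ib by blast
  qed
  have Q: "nilradical (lquotient (restr UNIV) I) = lcoset (restr UNIV) I ` ?S"
    using nilradical_quotient_eqI[OF I S IS Sk] greatest by blast
  then show "nilradical (lquotient (restr UNIV) I) = lcoset (restr UNIV) I ` lsum (restr UNIV) I N"
    unfolding lsum .
  let ?M = "nilradical (restr UNIV)"
  have UNIV: "subalgebra (restr UNIV) UNIV" by (simp add: subalgebra_restr)
  have M: "lideal (restr UNIV) ?M"
    using nilpotent_ideal_nilradical[OF UNIV] by (simp add: nilpotent_ideal_def)
  obtain m where m: "right_power ?M ?M m \<subseteq> {0}"
    using nilpotent_ideal_nilradical[OF UNIV] lnilpotent_restr[OF lideal_imp_subalgebra[OF M]]
    unfolding nilpotent_ideal_def by blast
  \<comment> \<open>Right multiplication by \<open>I\<close> is zero, so \<open>I\<close> is a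
    nilpotent ideal and lies in the nilradical \<open>?M\<close>.\<close>
  have "right_power I I (Suc 0) \<subseteq> {0}"
    unfolding right_power.simps by (rule span_minimal) (auto simp: xI)
  then have "nilpotent_ideal UNIV I"
    using I lnilpotent_restr[OF lideal_imp_subalgebra[OF I]] unfolding nilpotent_ideal_def by blast
  then have IM: "I \<subseteq> ?M" by (rule nilpotent_ideal_subset_nilradical[OF UNIV])
  \<comment> \<open>A nilpotent ideal is in particular nilpotent modulo \<open>I\<close>, so
    \<open>greatest\<close> applies to \<open>?M\<close>.\<close>
  have "?M \<subseteq> ?S" using greatest[OF M IM] m subspace_0[OF sI] by blast
  \<comment> \<open>Both ideals contain \<open>I\<close>, so each is recovered from its image in the
    quotient.\<close>
  have "lcoset (restr UNIV) I ` ?S = lcoset (restr UNIV) I ` ?M \<longleftrightarrow> ?S = ?M"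
  proof
    assume eq: "lcoset (restr UNIV) I ` ?S = lcoset (restr UNIV) I ` ?M"
    have "x \<in> ?S \<longleftrightarrow> x \<in> ?M" for x
      using coset_mem_image_iff[OF I _ IS, of x] coset_mem_image_iff[OF I _ IM, of x] S M
      unfolding eq lideal_restr by blast
    then show "?S = ?M" by blast
  qed simp
  also have "\<dots> \<longleftrightarrow> (\<forall>n\<in>N. \<exists>k. \<forall>y\<in>I. (right_mult n ^^ k) y = 0)"
  proof
    assume "?S = ?M"
    then have "N \<subseteq> ?M" using subspace_0[OF sI] by force
    \<comment> \<open>With \<open>n\<close> and \<open>I\<close> both inside \<open>?M\<close>, the
      \<open>m\<close>-th power of right multiplication by \<open>n\<close> maps \<open>I\<close>
      into the vanishing term of the series of \<open>?M\<close>.\<close>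
    then show "\<forall>n\<in>N. \<exists>k. \<forall>y\<in>I. (right_mult n ^^ k) y = 0"
      using right_mult_pow_in_right_power[of _ ?M _ ?M m] IM m by blast
  next
    assume nil: "\<forall>n\<in>N. \<exists>k. \<forall>y\<in>I. (right_mult n ^^ k) y = 0"
    have "\<exists>l. \<forall>v\<in>?S. (right_mult c ^^ l) v = 0" if "c \<in> ?S" for c
    proof -
      obtain j n where c: "j \<in> I" "n \<in> N" "c = j + n" using \<open>c \<in> ?S\<close> by blast
      \<comment> \<open>The component \<open>j\<close> in \<open>I\<close> contributes nothing on
        the right, so only \<open>n\<close> acts.\<close>
      have R: "right_mult c = right_mult n" using c by (auto simp: right_mult_def bracket_linear xI)
      obtain l where l: "\<forall>y\<in>I. (right_mult n ^^ l) y = 0" using nil c by blast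
      \<comment> \<open>Exponent \<open>k\<close> kills \<open>N\<close>, which is nilpotent, and
        exponent \<open>l\<close> kills \<open>I\<close> by hypothesis.\<close>
      have "(right_mult c ^^ max k l) (i + u) = 0" if "i \<in> I" "u \<in> N" for i u
      proof -
        have "(right_mult n ^^ k) u = 0"
          using right_mult_pow_in_right_power[of u N n N k] that c k by blast
        then show ?thesis using l that right_mult_pow_le[of k n u "max k l"]
            right_mult_pow_le[of l n i "max k l"] by (simp add: R right_mult_pow_add)
      qed
      then show ?thesis by blast
    qed
    then have "\<exists>l. right_power ?S ?S l \<subseteq> {0}"
      using S by (intro engel) (auto simp: lideal_restr)
    then have "nilpotent_ideal UNIV ?S"
      using S lnilpotent_restr[OF lideal_imp_subalgebra[OF S]] unfolding nilpotent_ideal_def by blast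
    then have "?S \<subseteq> ?M" by (rule nilpotent_ideal_subset_nilradical[OF UNIV])
    then show "?S = ?M" using \<open>?M \<subseteq> ?S\<close> by blast
  qed
  finally show "nilradical (lquotient (restr UNIV) I) = lcoset (restr UNIV) I ` ?M
      \<longleftrightarrow> (\<forall>n\<in>N. \<exists>k. \<forall>y\<in>I. (right_mult n ^^ k) y = 0)"
    unfolding Q .
qed

end

theorem theorem2p5:
  fixes scale :: "'f::field \<Rightarrow> 'v::ab_group_add \<Rightarrow> 'v"
    and bracket :: "'v \<Rightarrow> 'v \<Rightarrow> 'v"
    and Basis :: "'v set"
    and L :: "('f, 'v) lstruct"
    and I B :: "'v set"
  assumes "leibniz_algebra scale bracket"
    and "finite_dimensional_vector_space scale Basis"
    and "L = lstruct_of scale bracket"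
    and "I = leibniz_kernel L"
    and "\<not> I \<subseteq> frattini_ideal L"
    and "subalgebra L B"
    and "lcarrier L = lsum L I B"
    and "I \<inter> B \<subseteq> frattini_ideal (L\<lparr>lcarrier := B\<rparr>)"
  shows "nilradical (lquotient L I) = lcoset L I ` lsum L I (nilradical (L\<lparr>lcarrier := B\<rparr>))
    \<and> (nilradical (lquotient L I) = lcoset L I ` nilradical L \<longleftrightarrow>
        (\<forall>n \<in> nilradical (L\<lparr>lcarrier := B\<rparr>).
           \<exists>k. \<forall>y\<in>I. ((\<lambda>z. lbracket L z n) ^^ k) y = lzero L))"
proof -
  interpret fd_leibniz_algebra scale bracket Basis
    by (intro fd_leibniz_algebra.intro assms)
  have L: "L = restr UNIV" "L\<lparr>lcarrier := B\<rparr> = restr B"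
    using assms(3) lstruct_of_eq_restr by simp_all
  have B: "subalgebra (restr UNIV) B" using assms(6) L by simp
  have sum: "UNIV = lsum (restr UNIV) (leibniz_kernel (restr UNIV)) B"
    using assms(4,7) L by simp
  have fr: "leibniz_kernel (restr UNIV) \<inter> B \<subseteq> frattini_ideal (restr B)"
    using assms(4,8) L by simp
  have "nilradical (lquotient (restr UNIV) I) = lcoset (restr UNIV) I ` lsum (restr UNIV) I (nilradical (restr B))"
    using nilradical_quotient_leibniz_kernel[OF B sum fr] by (simp only: assms(4) L(1))
  moreover have "nilradical (lquotient (restr UNIV) I) = lcoset (restr UNIV) I ` nilradical (restr UNIV)
      \<longleftrightarrow> (\<forall>n\<in>nilradical (restr B). \<exists>k. \<forall>y\<in>I. ((\<lambda>z. z \<cdot> n) ^^ k) y = 0)"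
    using nilradical_quotient_leibniz_kernel_eq_iff[OF B sum fr]
    by (simp only: assms(4) L(1) right_mult_def)
  ultimately show ?thesis by (simp only: L(2)) (simp only: L(1) restr_simps simp_thms)
qed

end
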